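(* Let $\boldsymbol{\pi}_1,\boldsymbol{\pi}_2$ be two labeled multi-Bernoulli (LMB) multi-object densities on the finite subsets of $\mathbb{X}\times\mathbb{L}$, with parameters $\{(r_i(\ell),p_i(\cdot,\ell)):\ell\in D_i\}$ and $r_i(\ell)\in[0,1)$, $i=1,2$. Put $\tilde r_i=1-r_i$ and $\boldsymbol{f}_i(x,\ell)=r_i(\ell)p_i(x,\ell)/\tilde r_i(\ell)$, so that $\boldsymbol{\pi}_i(\boldsymbol{X})=\Delta(\boldsymbol{X})\big(\prod_{\ell\in\mathbb{L}}\tilde r_i(\ell)\big)\prod_{\boldsymbol{x}\in\boldsymbol{X}}\boldsymbol{f}_i(\boldsymbol{x})$. Then the Rényi divergence (with parameter $\alpha$) $$D_R(\boldsymbol{\pi}_1\|\boldsymbol{\pi}_2)=\frac{1}{\alpha-1}\ln\int\boldsymbol{\pi}_1^{\alpha}(\boldsymbol{X})\,\boldsymbol{\pi}_2^{1-\alpha}(\boldsymbol{X})\,\delta\boldsymbol{X}$$ is given by $$D_R(\boldsymbol{\pi}_1\|\boldsymbol{\pi}_2)=\sum_{\ell\in\mathbb{L}}\frac{\ln\!\big[1+\langle\boldsymbol{f}_1^{\alpha}\boldsymbol{f}_2^{1-\alpha}\rangle(\ell)\big]+\ln\!\big[\tilde r_1(\ell)^{\alpha}\,\tilde r_2(\ell)^{1-\alpha}\big]}{\alpha-1}.$$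
   Context: $\mathbb{X}$ is a finite-dimensional Euclidean space with Lebesgue measure (the attribute space) and $\mathbb{L}=\{\alpha_i:i\in\mathbb{N}\}$ is a discrete set (the label space; its elements $\alpha_i$ are unrelated to the divergence parameter $\alpha$). For a finite set $\boldsymbol{X}\subset\mathbb{X}\times\mathbb{L}$, $\mathcal{L}(\boldsymbol{X})=\{\ell:(x,\ell)\in\boldsymbol{X}\}$ is its set of labels, and the distinct label indicator $\Delta(\boldsymbol{X})$ equals $1$ if $|\mathcal{L}(\boldsymbol{X})|=|\boldsymbol{X}|$ and $0$ otherwise. The set integral of a function $F$ on finite subsets of $\mathbb{X}\times\mathbb{L}$ is $$\int F(\boldsymbol{X})\,\delta\boldsymbol{X}=\sum_{n=0}^{\infty}\frac1{n!}\sum_{(\ell_1,\dots,\ell_n)\in\mathbb{L}^n}\int_{\mathbb{X}^n}F(\{(x_1,\ell_1),\dots,(x_n,\ell_n)\})\,dx_1\cdots dx_n,$$ where the $n=0$ term is $F(\emptyset)$. For a function $\boldsymbol{f}$ on $\mathbb{X}\times\mathbb{L}$, $\langle\boldsymbol{f}\rangle(\ell)=\int_{\mathbb{X}}\boldsymbol{f}(x,\ell)\,dx$. An LMB with parameters $\{(r(\ell),p(\cdot,\ell)):\ell\in D\}$, where $D\subseteq\mathbb{L}$ is finite, $r(\ell)\in[0,1)$ is the existence probability of $\ell$ and $p(\cdot,\ell)$ is a probability density on $\mathbb{X}$, has multi-object density $\boldsymbol{\pi}(\boldsymbol{X})=\Delta(\boldsymbol{X})\big(\prod_{\ell\in\mathbb{L}}(1-r(\ell))\big)\prod_{(x,\ell)\in\boldsymbol{X}}\frac{r(\ell)p(x,\ell)}{1-r(\ell)}$,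 where $r(\ell)=0$ (and $r(\ell)p(\cdot,\ell)=0$) for $\ell\notin D$. Empty products equal $1$. *)

theory Defs
  imports "HOL-Analysis.Analysis" "HOL-Library.Groups_Big_Fun"
begin

text \<open>
  The attribute space is an arbitrary \<open>'a :: euclidean_space\<close>, the label space an arbitrary
  countable type \<open>'l\<close>. All integrals are taken in \<open>[0,\<infinity>]\<close> and logarithms in \<open>[-\<infinity>,\<infinity>]\<close>, so that
  no integrability assumption is needed: for \<open>\<alpha> > 1\<close> the divergence may be infinite.
\<close>

definition labels :: "('a \<times> 'l) set \<Rightarrow> 'l set" where
  "labels X = snd ` X"

definition distinct_label :: "('a \<times> 'l) set \<Rightarrow> real" where
  "distinct_label X = (if card (labels X) = card X then 1 else 0)"

text \<open>
  Points of \<open>X\<^sup>n\<close> and \<open>L\<^sup>n\<close> are extensional functions on \<open>{..<n}\<close>.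
\<close>
definition set_integral_labeled ::
    "(('a::euclidean_space \<times> 'l) set \<Rightarrow> ennreal) \<Rightarrow> ennreal" where
  "set_integral_labeled F =
     suminf (\<lambda>n. ennreal (1 / fact n) *
       (\<Sum>\<^sub>\<infinity>l\<in>{..<n} \<rightarrow>\<^sub>E UNIV.
          \<integral>\<^sup>+x. F ((\<lambda>i. (x i, l i)) ` {..<n}) \<partial>(\<Pi>\<^sub>M i\<in>{..<n}. lebesgue)))"

definition label_integral ::
    "('a::euclidean_space \<times> 'l \<Rightarrow> ennreal) \<Rightarrow> 'l \<Rightarrow> ennreal" where
  "label_integral f l = (\<integral>\<^sup>+x. f (x, l) \<partial>lebesgue)"

text \<open>
  Real powers of nonnegative reals with \<open>0\<^sup>a = \<infinity>\<close> for \<open>a < 0\<close>. Together with \<open>0 * \<infinity> = 0\<close> in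
  \<^typ>\<open>ennreal\<close> this is the usual convention for the integrand of the Renyi divergence. Since
  \<open>0 powr 0 = 0\<close>, at \<open>\<alpha> = 0\<close> the integrand is the second density restricted to the support
  of the first.
\<close>
definition epow :: "real \<Rightarrow> real \<Rightarrow> ennreal" where
  "epow x a = (if x = 0 \<and> a < 0 then \<infinity> else ennreal (x powr a))"

definition eln :: "ennreal \<Rightarrow> ereal" where
  "eln x = (if x = 0 then -\<infinity> else if x = \<infinity> then \<infinity> else ereal (ln (enn2real x)))"

definition renyi_divergence ::
    "real \<Rightarrow> (('a::euclidean_space \<times> 'l) set \<Rightarrow> real) \<Rightarrow> (('a \<times> 'l) set \<Rightarrow> real) \<Rightarrow> ereal" where
  "renyi_divergence \<alpha> \<pi>1 \<pi>2 =
     ereal (1 / (\<alpha> - 1)) *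
     eln (set_integral_labeled (\<lambda>X. epow (\<pi>1 X) \<alpha> * epow (\<pi>2 X) (1 - \<alpha>)))"

definition prob_density :: "('a::euclidean_space \<Rightarrow> real) \<Rightarrow> bool" where
  "prob_density q \<longleftrightarrow>
     q \<in> borel_measurable lebesgue \<and> (\<forall>x. 0 \<le> q x) \<and> (\<integral>\<^sup>+x. ennreal (q x) \<partial>lebesgue) = 1"

definition lmb_params ::
    "'l set \<Rightarrow> ('l \<Rightarrow> real) \<Rightarrow> ('a::euclidean_space \<times> 'l \<Rightarrow> real) \<Rightarrow> bool" where
  "lmb_params D r p \<longleftrightarrow>
     finite D \<and>
     (\<forall>l\<in>D. 0 \<le> r l \<and> r l < 1 \<and> prob_density (\<lambda>x. p (x, l))) \<and>
     (\<forall>l. l \<notin> D \<longrightarrow> r l = 0)"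

definition lmb_weight ::
    "('l \<Rightarrow> real) \<Rightarrow> ('a \<times> 'l \<Rightarrow> real) \<Rightarrow> 'a \<times> 'l \<Rightarrow> real" where
  "lmb_weight r p z = r (snd z) * p z / (1 - r (snd z))"

text \<open>
  The product over the possibly infinite label space is a \<^const>\<open>Prod_any\<close>: under
  \<^const>\<open>lmb_params\<close> only finitely many factors differ from 1.
\<close>
definition lmb_density ::
    "('l \<Rightarrow> real) \<Rightarrow> ('a \<times> 'l \<Rightarrow> real) \<Rightarrow> ('a \<times> 'l) set \<Rightarrow> real" where
  "lmb_density r p X =
     distinct_label X * Prod_any (\<lambda>l. 1 - r l) * (\<Prod>z\<in>X. lmb_weight r p z)"

end

(* With the stated conventions for 0 and \<infinity>, real powers are multiplicative, so the integrand of
   the divergence is a constant times \<Prod>z\<in>X. g z on sets X with distinct labels, and 0 on all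
   others. In the set integral, tuples with n distinct labels are counted n! times, which cancels
   1/n!, and Tonelli turns the integral into the sum over label sets S of
   \<Prod>l\<in>S. \<integral>g(x, l) dx. This sum is the expansion of \<Prod>l. (1 + \<integral>g(x, l) dx), a finite product
   of nonzero factors, so its logarithm is a sum that never meets \<infinity> - \<infinity>. *)
theory Submission imports Defs begin

section \<open>Extended powers and logarithms\<close>

lemma epow_eq_ennreal: "x > 0 \<Longrightarrow> epow x a = ennreal (x powr a)"
  by (simp add: epow_def)

text \<open>For fixed \<open>a\<close>, the values on nonnegative reals are all nonzero if
  \<open>a < 0\<close> and all finite otherwise, so the product never meets 0 * \<infinity>.\<close>

lemma epow_mult:
  assumes "0 \<le> x" "0 \<le> y"
  shows "epow (x * y) a = epow x a * epow y a"
  using assms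
  by (auto simp: epow_def powr_mult ennreal_mult ennreal_mult_top ennreal_top_mult)

lemma epow_1: "epow 1 a = 1"
  by (simp add: epow_def)

lemma epow_prod:
  assumes "\<And>i. i \<in> I \<Longrightarrow> 0 \<le> f i"
  shows "epow (\<Prod>i\<in>I. f i) a = (\<Prod>i\<in>I. epow (f i) a)"
  using assms
  by (induction I rule: infinite_finite_induct) (auto simp: epow_1 epow_mult prod_nonneg)

text \<open>One of the exponents is nonnegative, so that factor is 0, also against \<open>\<infinity>\<close>.\<close>
lemma epow_0_mult: "epow 0 a * epow 0 (1 - a) = 0"
  by (auto simp: epow_def)

lemma borel_measurable_epow [measurable]:
  assumes [measurable]: "f \<in> borel_measurable M"
  shows "(\<lambda>x. epow (f x) a) \<in> borel_measurable M"
  unfolding epow_def by measurable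

lemma eln_ennreal: "x > 0 \<Longrightarrow> eln (ennreal x) = ereal (ln x)"
  by (simp add: eln_def)

lemma eln_1: "eln 1 = 0"
  by (simp add: eln_def zero_ereal_def)

lemma eln_eq_minf_iff: "eln x = -\<infinity> \<longleftrightarrow> x = 0"
  by (auto simp: eln_def)

text \<open>Zero factors are excluded because 0 * \<infinity> = 0 in \<open>ennreal\<close>, whereas
  -\<infinity> + \<infinity> = \<infinity> in \<open>ereal\<close>.\<close>

lemma eln_mult:
  assumes "x \<noteq> 0" "y \<noteq> 0"
  shows "eln (x * y) = eln x + eln y"
proof (cases "x = \<infinity> \<or> y = \<infinity>")
  case True
  with assms show ?thesis
    by (auto simp: eln_def ennreal_top_mult ennreal_mult_top)
next
  case False
  then have "0 < enn2real x" "0 < enn2real y"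
    using assms by (auto simp: enn2real_positive_iff less_top zero_less_iff_neq_zero)
  with False assms show ?thesis
    by (auto simp: eln_def enn2real_mult ln_mult ennreal_mult_eq_top_iff)
qed

lemma eln_prod:
  assumes "\<And>i. i \<in> I \<Longrightarrow> f i \<noteq> 0"
  shows "eln (\<Prod>i\<in>I. f i) = (\<Sum>i\<in>I. eln (f i))"
  using assms
  by (induction I rule: infinite_finite_induct) (auto simp: eln_1 eln_mult)

text \<open>The scalar will be 1 / (\<alpha> - 1), possibly negative. Distributivity holds because
  infinities of opposite sign are never added.\<close>

lemma sum_ereal_cmult_not_minf:
  fixes f :: "'i \<Rightarrow> ereal"
  assumes "\<And>i. i \<in> I \<Longrightarrow> f i \<noteq> -\<infinity>"
  shows "ereal c * (\<Sum>i\<in>I. f i) = (\<Sum>i\<in>I. ereal c * f i)"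
  using assms
proof (induction I rule: infinite_finite_induct)
  case (insert i I)
  then have "\<And>j. j \<in> I \<Longrightarrow> f j \<noteq> -\<infinity>"
    by simp
  then have "sum f I \<noteq> -\<infinity>"
    by (induction I rule: infinite_finite_induct) auto
  with insert show ?case
    by (simp add: ereal_distrib_left)
qed auto

section \<open>Products of Lebesgue measures\<close>

text \<open>Completion keeps the measure of the old sets, so the same countable cover works. Since
  \<open>lebesgue\<close> completes \<open>lborel\<close>, this gives Tonelli for its finite
  powers.\<close>

lemma sigma_finite_completion:
  assumes "sigma_finite_measure M"
  shows "sigma_finite_measure (completion M)"
proof
  obtain A where "countable A" "A \<subseteq> sets M" "\<Union>A = space M" "\<forall>a\<in>A. emeasure M a \<noteq> \<infinity>"
    using sigma_finite_measure.sigma_finite_countable[OF assms] by blast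
  then show "\<exists>A. countable A \<and> A \<subseteq> sets (completion M) \<and> \<Union>A = space (completion M) \<and>
      (\<forall>a\<in>A. emeasure (completion M) a \<noteq> \<infinity>)"
    by (intro exI[of _ A]) (auto simp: subset_eq)
qed

interpretation lebesgue_product: product_sigma_finite "\<lambda>_. lebesgue :: 'a::euclidean_space measure"
  by (intro product_sigma_finite.intro sigma_finite_completion sigma_finite_lborel)

text \<open>By Tonelli: with the other coordinates fixed, coordinate \<open>j\<close> is confined to
  the single point \<open>x i\<close>, a null set.\<close>

lemma AE_PiM_lebesgue_neq:
  fixes I :: "'i set"
  assumes "finite I" "i \<in> I" "j \<in> I" "i \<noteq> j"
  shows "AE x in PiM I (\<lambda>_. lebesgue :: 'a::euclidean_space measure). x i \<noteq> x j"
proof -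
  let ?M = "\<lambda>_::'i. lebesgue :: 'a measure"
  define A where "A = {x \<in> space (PiM I ?M). x i = x j}"
  \<comment> \<open>Components map into \<open>lebesgue\<close>; composing with the identity weakens
    the target to the Borel sets, where equality sets are known to be measurable.\<close>
  have comp: "(\<lambda>x. x k) \<in> borel_measurable (PiM I ?M)" if "k \<in> I" for k
    using measurable_compose[OF measurable_component_singleton[OF that] 
        measurable_completion[OF measurable_ident_sets[OF sets_lborel]]]
    by simp
  have A: "A \<in> sets (PiM I ?M)"
    unfolding A_def using comp assms by (intro measurable_equality_set) auto
  define J where "J = I - {j}"
  have J: "I = insert j J" "finite J" "j \<notin> J" "i \<in> J"
    using assms by (auto simp: J_def)
  have "emeasure (PiM I ?M) A = (\<integral>\<^sup>+x. indicator A x \<partial>PiM (insert j J) ?M)"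
    using A J(1) by simp
  also have "\<dots> = (\<integral>\<^sup>+x. (\<integral>\<^sup>+y. indicator A (x(j := y)) \<partial>lebesgue) \<partial>PiM J ?M)"
    using A J by (intro lebesgue_product.product_nn_integral_insert) auto
  also have "\<dots> \<le> (\<integral>\<^sup>+x. (\<integral>\<^sup>+y. indicator {x i} y \<partial>lebesgue) \<partial>PiM J ?M)"
    using assms by (intro nn_integral_mono) (auto simp: A_def indicator_def)
  also have "\<dots> = 0"
    by simp
  finally have "A \<in> null_sets (PiM I ?M)"
    using A by (simp add: null_setsI)
  then show ?thesis
    by (rule AE_I') (auto simp: A_def)
qed

section \<open>Set integrals of multiplicative functions with distinct labels\<close>

text \<open>Injections are grouped by image: the product depends only on the image, and each
  \<open>n\<close>-element subset of \<open>D\<close> is the image of exactly n! of them.\<close>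

lemma sum_prod_injections:
  fixes h :: "'l \<Rightarrow> 'b::comm_semiring_1"
  assumes D: "finite D"
  shows "(\<Sum>f\<in>{f \<in> {..<n} \<rightarrow>\<^sub>E D. inj_on f {..<n}}. \<Prod>i<n. h (f i)) =
    of_nat (fact n) * (\<Sum>S\<in>{S \<in> Pow D. card S = n}. \<Prod>l\<in>S. h l)"
proof -
  let ?E = "{f \<in> {..<n} \<rightarrow>\<^sub>E D. inj_on f {..<n}}"
  let ?T = "{S \<in> Pow D. card S = n}"
  have fin: "finite ?E" "finite ?T"
    using D by (auto intro!: finite_subset[OF _ finite_PiE[of "{..<n}" "\<lambda>_. D"]])
  have img: "(\<lambda>f. f ` {..<n}) ` ?E \<subseteq> ?T"
  proof (rule image_subsetI)
    fix f assume "f \<in> ?E"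
    then have "f ` {..<n} \<subseteq> D" "card (f ` {..<n}) = n"
      using card_image[of f "{..<n}"] by (simp_all add: PiE_iff image_subset_iff)
    then show "f ` {..<n} \<in> ?T"
      by simp
  qed
  have "(\<Sum>f\<in>?E. \<Prod>i<n. h (f i)) =
      (\<Sum>S\<in>?T. \<Sum>f\<in>{f \<in> ?E. f ` {..<n} = S}. \<Prod>i<n. h (f i))"
    by (rule sum.group[where g = "\<lambda>f. f ` {..<n}", OF fin img, symmetric])
  also have "\<dots> = (\<Sum>S\<in>?T. of_nat (fact n) * (\<Prod>l\<in>S. h l))"
  proof (intro sum.cong refl)
    fix S assume S: "S \<in> ?T"
    then have finS: "finite S"
      using D finite_subset by auto
    have eq: "{f \<in> ?E. f ` {..<n} = S} = {f \<in> {..<n} \<rightarrow>\<^sub>E S. inj_on f {..<n}}"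
    proof (intro equalityI subsetI)
      fix f assume "f \<in> {f \<in> {..<n} \<rightarrow>\<^sub>E S. inj_on f {..<n}}"
      then have f: "f \<in> {..<n} \<rightarrow>\<^sub>E S" "inj_on f {..<n}"
        by auto
      then have "f ` {..<n} \<subseteq> S" "card (f ` {..<n}) = card S"
        using S by (auto simp: card_image)
      then have "f ` {..<n} = S"
        by (intro card_subset_eq finS)
      with f S show "f \<in> {f \<in> ?E. f ` {..<n} = S}"
        by (auto simp: PiE_iff)
    qed (auto simp: PiE_iff)
    have "(\<Prod>i<n. h (f i)) = (\<Prod>l\<in>S. h l)" if "f \<in> {f \<in> ?E. f ` {..<n} = S}" for f
    proof -
      from that have "inj_on f {..<n}" "f ` {..<n} = S"
        by blast+
      then show ?thesis
        using prod.reindex[of f "{..<n}" h] by (simp add: o_def)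
    qed
    then have "(\<Sum>f\<in>{f \<in> ?E. f ` {..<n} = S}. \<Prod>i<n. h (f i)) =
        of_nat (card {f \<in> ?E. f ` {..<n} = S}) * (\<Prod>l\<in>S. h l)"
      by simp
    \<comment> \<open>As \<open>card S = n\<close>, the number of injections is the product of
      \<open>n - i\<close> over \<open>i < n\<close>.\<close>
    also have "card {f \<in> ?E. f ` {..<n} = S} = fact n"
      unfolding eq using card_inj_on_subset_funcset[of "{..<n}" S "{..<n}"] finS S
      by (simp add: fact_prod_rev atLeast0LessThan)
    finally show "(\<Sum>f\<in>{f \<in> ?E. f ` {..<n} = S}. \<Prod>i<n. h (f i)) = of_nat (fact n) * (\<Prod>l\<in>S. h l)"
      by simp
  qed
  finally show ?thesis
    by (simp add: sum_distrib_left)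
qed

lemma prod_one_plus:
  fixes h :: "'l \<Rightarrow> 'b::comm_semiring_1"
  assumes "finite D"
  shows "(\<Prod>l\<in>D. 1 + h l) = (\<Sum>S\<in>Pow D. \<Prod>l\<in>S. h l)"
  using prod_add[OF assms, of h "\<lambda>_. 1"] by (simp add: add.commute)

text \<open>
  Label tuples with a repetition contribute nothing: off the null set where two coordinates
  coincide, the resulting point set has a repeated label.
\<close>
lemma nn_integral_labeled_tuple:
  fixes g :: "'a::euclidean_space \<times> 'l \<Rightarrow> ennreal" and F :: "('a \<times> 'l) set \<Rightarrow> ennreal"
    and l :: "nat \<Rightarrow> 'l"
  assumes g: "\<And>l. (\<lambda>x. g (x, l)) \<in> borel_measurable lebesgue"
    and F: "\<And>X. finite X \<Longrightarrow> F X = (if inj_on snd X then C * (\<Prod>z\<in>X. g z) else 0)"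
  shows "(\<integral>\<^sup>+x. F ((\<lambda>i. (x i, l i)) ` {..<n}) \<partial>(\<Pi>\<^sub>M i\<in>{..<n}. lebesgue)) =
    (if inj_on l {..<n} then C * (\<Prod>i<n. label_integral g (l i)) else 0)"
proof (cases "inj_on l {..<n}")
  case True
  let ?M = "PiM {..<n} (\<lambda>_. lebesgue :: 'a measure)"
  \<comment> \<open>Distinct labels make the points distinct, so the product over the point set can
    be reindexed by \<open>{..<n}\<close>.\<close>
  have "F ((\<lambda>i. (x i, l i)) ` {..<n}) = C * (\<Prod>i<n. g (x i, l i))" for x
  proof -
    have "inj_on (\<lambda>i. (x i, l i)) {..<n}" "inj_on snd ((\<lambda>i. (x i, l i)) ` {..<n})"
      using True by (auto simp: inj_on_def)
    then show ?thesis
      by (simp add: F prod.reindex)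
  qed
  then have "(\<integral>\<^sup>+x. F ((\<lambda>i. (x i, l i)) ` {..<n}) \<partial>?M) =
      (\<integral>\<^sup>+x. C * (\<Prod>i<n. g (x i, l i)) \<partial>?M)"
    by simp
  also have "\<dots> = C * (\<integral>\<^sup>+x. (\<Prod>i<n. g (x i, l i)) \<partial>?M)"
  proof (intro nn_integral_cmult borel_measurable_prod_ennreal)
    fix i assume "i \<in> {..<n}"
    then show "(\<lambda>x. g (x i, l i)) \<in> borel_measurable ?M"
      by (rule measurable_compose[OF measurable_component_singleton[of i _ "\<lambda>_. lebesgue"] g])
  qed
  also have "(\<integral>\<^sup>+x. (\<Prod>i<n. g (x i, l i)) \<partial>?M) = (\<Prod>i<n. label_integral g (l i))"
    unfolding label_integral_def
    by (intro lebesgue_product.product_nn_integral_prod[where f = "\<lambda>i x. g (x, l i)"] g) auto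
  finally show ?thesis
    using True by simp
next
  case False
  then obtain i j where ij: "i < n" "j < n" "i \<noteq> j" "l i = l j"
    by (auto simp: inj_on_def)
  have "AE x in PiM {..<n} (\<lambda>_. lebesgue :: 'a measure). F ((\<lambda>i. (x i, l i)) ` {..<n}) = 0"
    using AE_PiM_lebesgue_neq[of "{..<n}" i j]
  proof (rule AE_mp)
    show "AE x in PiM {..<n} (\<lambda>_. lebesgue :: 'a measure).
        x i \<noteq> x j \<longrightarrow> F ((\<lambda>i. (x i, l i)) ` {..<n}) = 0"
    proof (intro AE_I2 impI)
      fix x :: "nat \<Rightarrow> 'a" assume neq: "x i \<noteq> x j"
      let ?X = "(\<lambda>i. (x i, l i)) ` {..<n}"
      have mem: "(x i, l i) \<in> ?X" "(x j, l j) \<in> ?X"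
        using ij by blast+
      have "\<not> inj_on snd ?X"
      proof
        assume "inj_on snd ?X"
        from inj_onD[OF this _ mem] ij neq show False
          by simp
      qed
      then show "F ((\<lambda>i. (x i, l i)) ` {..<n}) = 0"
        by (simp add: F)
    qed
  qed (use ij in auto)
  then have "(\<integral>\<^sup>+x. F ((\<lambda>i. (x i, l i)) ` {..<n}) \<partial>(\<Pi>\<^sub>M i\<in>{..<n}. lebesgue)) =
      (\<integral>\<^sup>+x. 0 \<partial>PiM {..<n} (\<lambda>_. lebesgue :: 'a measure))"
    by (rule nn_integral_cong_AE)
  with False show ?thesis
    by simp
qed

lemma set_integral_labeled_prod:
  fixes g :: "'a::euclidean_space \<times> 'l \<Rightarrow> ennreal" and F :: "('a \<times> 'l) set \<Rightarrow> ennreal"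
  assumes D: "finite D"
    and g: "\<And>l. (\<lambda>x. g (x, l)) \<in> borel_measurable lebesgue"
    and g0: "\<And>x l. l \<notin> D \<Longrightarrow> g (x, l) = 0"
    and F: "\<And>X. finite X \<Longrightarrow> F X = (if inj_on snd X then C * (\<Prod>z\<in>X. g z) else 0)"
  shows "set_integral_labeled F = C * (\<Prod>l\<in>D. 1 + label_integral g l)"
proof -
  let ?h = "label_integral g"
  \<comment> \<open>The elementary symmetric polynomial of degree \<open>n\<close> in the label
    integrals over \<open>D\<close>.\<close>
  define e where "e n = (\<Sum>S\<in>{S \<in> Pow D. card S = n}. \<Prod>l\<in>S. ?h l)" for n
  have h0: "?h l = 0" if "l \<notin> D" for l
    using g0[OF that] by (simp add: label_integral_def)
  have level: "(\<Sum>\<^sub>\<infinity>l\<in>{..<n} \<rightarrow>\<^sub>E UNIV.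
      \<integral>\<^sup>+x. F ((\<lambda>i. (x i, l i)) ` {..<n}) \<partial>(\<Pi>\<^sub>M i\<in>{..<n}. lebesgue)) = C * (of_nat (fact n) * e n)" for n
  proof -
    let ?E = "{f \<in> {..<n} \<rightarrow>\<^sub>E D. inj_on f {..<n}}"
    have fin: "finite ?E"
      using D by (auto intro!: finite_subset[OF _ finite_PiE[of "{..<n}" "\<lambda>_. D"]])
    have "(\<Sum>\<^sub>\<infinity>l\<in>{..<n} \<rightarrow>\<^sub>E UNIV.
        \<integral>\<^sup>+x. F ((\<lambda>i. (x i, l i)) ` {..<n}) \<partial>(\<Pi>\<^sub>M i\<in>{..<n}. lebesgue)) =
        (\<Sum>\<^sub>\<infinity>l\<in>?E. C * (\<Prod>i<n. ?h (l i)))"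
    \<comment> \<open>A label outside \<open>D\<close> contributes a zero factor, so only finitely
      many tuples remain.\<close>
    proof (rule infsum_cong_neutral)
      fix l :: "nat \<Rightarrow> 'l" assume l: "l \<in> ({..<n} \<rightarrow>\<^sub>E UNIV) - ?E"
      then have "\<not> inj_on l {..<n} \<or> (\<exists>i<n. l i \<notin> D)"
        by (auto simp: PiE_iff)
      then show "(\<integral>\<^sup>+x. F ((\<lambda>i. (x i, l i)) ` {..<n}) \<partial>(\<Pi>\<^sub>M i\<in>{..<n}. lebesgue)) = 0"
        using h0 by (auto simp: nn_integral_labeled_tuple[OF g F])
    qed (auto simp: nn_integral_labeled_tuple[OF g F] PiE_iff)
    also have "\<dots> = C * (\<Sum>l\<in>?E. \<Prod>i<n. ?h (l i))"
      using fin by (simp add: sum_distrib_left)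
    also have "\<dots> = C * (of_nat (fact n) * e n)"
      by (simp add: sum_prod_injections[OF D] e_def)
    finally show ?thesis .
  qed
  have cancel: "ennreal (1 / fact n) * (C * (of_nat (fact n) * e n)) = C * e n" for n
  proof -
    have "ennreal (1 / fact n) * of_nat (fact n) = 1"
      by (simp add: ennreal_of_nat_eq_real_of_nat flip: ennreal_mult)
    then show ?thesis
      by (metis mult.assoc mult.commute mult.left_neutral)
  qed
  have "set_integral_labeled F = suminf (\<lambda>n. C * e n)"
    unfolding set_integral_labeled_def level cancel ..
  \<comment> \<open>The series stops because \<open>D\<close> has no subset of more than
    \<open>card D\<close> elements.\<close>
  also have "\<dots> = (\<Sum>n\<le>card D. C * e n)"
  proof (rule suminf_finite)
    fix n assume "n \<notin> {..card D}"
    then have "{S \<in> Pow D. card S = n} = {}"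
      using card_mono[OF D] by auto
    then show "C * e n = 0"
      by (simp only: e_def) simp
  qed simp
  also have "\<dots> = C * (\<Sum>n\<le>card D. e n)"
    by (simp add: sum_distrib_left)
  also have "(\<Sum>n\<le>card D. e n) = (\<Sum>S\<in>Pow D. \<Prod>l\<in>S. ?h l)"
    unfolding e_def using D card_mono[OF D] by (intro sum.group) auto
  finally show ?thesis
    by (simp add: prod_one_plus[OF D])
qed

section \<open>Labeled multi-Bernoulli densities\<close>

lemma distinct_label_eq:
  "finite X \<Longrightarrow> distinct_label X = (if inj_on snd X then 1 else 0)"
  by (auto simp: distinct_label_def labels_def card_image eq_card_imp_inj_on)

lemma lmb_params_bounds:
  assumes "lmb_params D r p"
  shows "0 \<le> r l" "r l < 1"
  using assms by (cases "l \<in> D"; auto simp: lmb_params_def)+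

lemma lmb_weight_outside: "lmb_params D r p \<Longrightarrow> l \<notin> D \<Longrightarrow> lmb_weight r p (x, l) = 0"
  by (simp add: lmb_params_def lmb_weight_def)

text \<open>Outside \<open>D\<close> nothing is known about \<open>p\<close>, but there
  \<open>r\<close> vanishes and with it the weight.\<close>

lemma lmb_weight_nonneg:
  assumes "lmb_params D r p"
  shows "0 \<le> lmb_weight r p z"
proof (cases "snd z \<in> D")
  case True
  with assms have "0 \<le> p (fst z, snd z)"
    unfolding lmb_params_def prob_density_def by blast
  with lmb_params_bounds[OF assms, of "snd z"] show ?thesis
    by (simp add: lmb_weight_def)
next
  case False
  with lmb_weight_outside[OF assms, of "snd z" "fst z"] show ?thesis
    by simp
qed

lemma lmb_weight_measurable:
  assumes "lmb_params D r p"
  shows "(\<lambda>x. lmb_weight r p (x, l)) \<in> borel_measurable lebesgue"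
proof (cases "l \<in> D")
  case True
  with assms have [measurable]: "(\<lambda>x. p (x, l)) \<in> borel_measurable lebesgue"
    by (auto simp: lmb_params_def prob_density_def)
  show ?thesis
    unfolding lmb_weight_def by simp
qed (simp add: lmb_weight_outside[OF assms])

text \<open>The superset \<open>D'\<close> lets two densities share one index set. The value
  \<open>epow 0 a\<close> may be \<infinity>; it disappears only after multiplication with the other
  density's power.\<close>

lemma epow_lmb_density:
  assumes lmb: "lmb_params D r p" and D': "finite D'" "D \<subseteq> D'" and X: "finite X"
  shows "epow (lmb_density r p X) a =
    (if inj_on snd X
     then ennreal (\<Prod>l\<in>D'. (1 - r l) powr a) * (\<Prod>z\<in>X. epow (lmb_weight r p z) a)
     else epow 0 a)"
proof (cases "inj_on snd X")
  case True
  have R: "Prod_any (\<lambda>l. 1 - r l) = (\<Prod>l\<in>D'. 1 - r l)"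
    using lmb D' by (intro Prod_any.expand_superset) (auto simp: lmb_params_def)
  have pos: "0 < 1 - r l" for l
    using lmb_params_bounds[OF lmb] by simp
  have "lmb_density r p X = (\<Prod>l\<in>D'. 1 - r l) * (\<Prod>z\<in>X. lmb_weight r p z)"
    using True X by (simp add: lmb_density_def distinct_label_eq R)
  \<comment> \<open>The deleted simp rule would turn \<open>0 \<le> 1 - r l\<close> into
    \<open>r l \<le> 1\<close>, which \<open>pos\<close> no longer matches.\<close>
  also have "epow \<dots> a = epow (\<Prod>l\<in>D'. 1 - r l) a * (\<Prod>z\<in>X. epow (lmb_weight r p z) a)"
    using pos lmb_weight_nonneg[OF lmb]
    by (simp add: epow_mult epow_prod prod_nonneg less_imp_le del: diff_ge_0_iff_ge)
  also have "epow (\<Prod>l\<in>D'. 1 - r l) a = ennreal (\<Prod>l\<in>D'. (1 - r l) powr a)"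
    using pos by (simp add: epow_prod less_imp_le epow_eq_ennreal prod_ennreal
        del: diff_ge_0_iff_ge diff_gt_0_iff_gt)
  finally show ?thesis
    using True by simp
qed (simp add: lmb_density_def distinct_label_eq X)

theorem mainTheorem1:
  fixes D1 D2 :: "'l::countable set"
    and r1 r2 :: "'l \<Rightarrow> real"
    and p1 p2 :: "'a::euclidean_space \<times> 'l \<Rightarrow> real"
    and \<alpha> :: real
  assumes "lmb_params D1 r1 p1"
    and "lmb_params D2 r2 p2"
    and "\<alpha> \<noteq> 1"
  shows "renyi_divergence \<alpha> (lmb_density r1 p1) (lmb_density r2 p2) =
    (\<Sum>\<^sub>\<infinity>l.
      (eln (1 + label_integral
                  (\<lambda>z. epow (lmb_weight r1 p1 z) \<alpha> * epow (lmb_weight r2 p2 z) (1 - \<alpha>)) l)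
       + ereal (ln ((1 - r1 l) powr \<alpha> * (1 - r2 l) powr (1 - \<alpha>))))
      / ereal (\<alpha> - 1))"
proof -
  \<comment> \<open>The union is needed: where just one weight vanishes, \<open>g\<close> can be
    \<infinity>; where both do, it is 0.\<close>
  define D where "D = D1 \<union> D2"
  have D: "finite D" "D1 \<subseteq> D" "D2 \<subseteq> D"
    using assms by (auto simp: D_def lmb_params_def)
  define g where
    "g = (\<lambda>z. epow (lmb_weight r1 p1 z) \<alpha> * epow (lmb_weight r2 p2 z) (1 - \<alpha>))"
  define k where "k l = (1 - r1 l) powr \<alpha> * (1 - r2 l) powr (1 - \<alpha>)" for l
  define t where "t l = eln (1 + label_integral g l) + ereal (ln (k l))" for l
  have k: "0 < k l" for l
    using lmb_params_bounds(2)[OF assms(1), of l] lmb_params_bounds(2)[OF assms(2), of l]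
    by (simp add: k_def)
  have [measurable]: "(\<lambda>x. lmb_weight r1 p1 (x, l)) \<in> borel_measurable lebesgue"
    "(\<lambda>x. lmb_weight r2 p2 (x, l)) \<in> borel_measurable lebesgue" for l
    using assms by (auto intro: lmb_weight_measurable)
  have g: "(\<lambda>x. g (x, l)) \<in> borel_measurable lebesgue" for l
    unfolding g_def by measurable
  have g0: "g (x, l) = 0" if "l \<notin> D" for x l
    using that lmb_weight_outside[OF assms(1)] lmb_weight_outside[OF assms(2)]
    by (simp add: g_def D_def epow_0_mult)
  have "epow (lmb_density r1 p1 X) \<alpha> * epow (lmb_density r2 p2 X) (1 - \<alpha>) =
      (if inj_on snd X then (\<Prod>l\<in>D. ennreal (k l)) * (\<Prod>z\<in>X. g z) else 0)" if "finite X" for X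
  proof -
    have "(\<Prod>l\<in>D. ennreal (k l)) =
        ennreal (\<Prod>l\<in>D. (1 - r1 l) powr \<alpha>) * ennreal (\<Prod>l\<in>D. (1 - r2 l) powr (1 - \<alpha>))"
      by (simp add: k_def ennreal_mult prod.distrib prod_ennreal)
    then show ?thesis
      by (simp add: epow_lmb_density[OF assms(1) D(1,2) that]
          epow_lmb_density[OF assms(2) D(1,3) that] epow_0_mult g_def prod.distrib mult_ac)
  qed
  from set_integral_labeled_prod[OF D(1) g g0 this]
  have "renyi_divergence \<alpha> (lmb_density r1 p1) (lmb_density r2 p2) =
      ereal (1 / (\<alpha> - 1)) * eln (\<Prod>l\<in>D. (1 + label_integral g l) * ennreal (k l))"
    by (simp add: renyi_divergence_def prod.distrib mult.commute)
  \<comment> \<open>Every factor is nonzero: \<open>1 + label_integral g l\<close> is at least 1 and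
    \<open>k l\<close> is positive.\<close>
  also have "eln (\<Prod>l\<in>D. (1 + label_integral g l) * ennreal (k l)) = (\<Sum>l\<in>D. t l)"
    using k by (simp add: eln_prod t_def eln_mult eln_ennreal ennreal_eq_0_iff not_le)
  also have "ereal (1 / (\<alpha> - 1)) * \<dots> = (\<Sum>l\<in>D. ereal (1 / (\<alpha> - 1)) * t l)"
    by (intro sum_ereal_cmult_not_minf) (auto simp: t_def eln_eq_minf_iff)
  also have "\<dots> = (\<Sum>l\<in>D. t l / ereal (\<alpha> - 1))"
    using assms(3) by (simp add: divide_ereal_def mult.commute divide_inverse)
  also have "\<dots> = (\<Sum>\<^sub>\<infinity>l. t l / ereal (\<alpha> - 1))"
  proof -
    \<comment> \<open>Here both existence probabilities and \<open>g\<close> vanish, leaving ln 1 +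
      ln 1.\<close>
    have "t l = 0" if "l \<notin> D" for l
      using that assms(1,2) g0[OF that]
      by (simp add: t_def k_def lmb_params_def label_integral_def D_def eln_1)
    then have "(\<Sum>\<^sub>\<infinity>l. t l / ereal (\<alpha> - 1)) = (\<Sum>\<^sub>\<infinity>l\<in>D. t l / ereal (\<alpha> - 1))"
      by (intro infsum_cong_neutral) auto
    with D show ?thesis
      by simp
  qed
  finally show ?thesis
    by (simp add: t_def k_def g_def)
qed

end
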